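(* Let $\mathbb{X}\in\{\mathbb{N},\mathbb{Z}\}$, let $S$ be a finite alphabet, and let $X \subset S^{\mathbb{X}}$ be a subshift with $h(X) > \log_2(|S|-1)$. Let $\epsilon>0$ be such that $\left( \frac{2 e}{\epsilon} \right)^{\epsilon} < \frac{2^{h(X)}}{|S|-1}$. Then $h(W(X)) \geq \epsilon$.
   Context: $S^*$ is the set of finite words over $S$ (including the empty word), $0\in\mathbb{N}$, and $e$ is the base of the natural logarithm. Games: let $n \in \mathbb{N}$ or $n=\mathbb{N}$, let $X \subset S^n$ and $a \in \{A,B\}^n$ (the turn order). Two players $A$ and $B$ build a word (infinite sequence if $n=\mathbb{N}$) $w \in S^n$ one letter at a time, starting from coordinate $0$; the letter $w_i$ is chosen by player $a_i$, knowing $w_0\cdots w_{i-1}$. Player $A$ wins if $w \in X$, otherwise $B$ wins. A strategy is a function assigning a letter of $S$ to each finite word of length less than $n$ (any finite word if $n=\mathbb{N}$); a strategy of $A$ is winning if the resulting word lies in $X$ whatever strategy $B$ uses. The winning set is $W(X) = \{a \in \{A,B\}^n : A \text{ has a winning strategy for the game with target set } X \text{ and turn order } a\}$. For a language $L \subset S^*$, $W(L) = \bigcup_{n\in\mathbb{N}} W(L\cap S^n)$. Subshifts: for $F \subset S^*$, let $\mathcal{X}_F$ be the set of $x \in S^{\mathbb{X}}$ in which no word of $F$ appears as a contiguous factor; subshifts are exactly the sets of this form. $\mathcal{B}_n(X)$ is the set of words of length $n$ appearing in points of $X$, and $\mathcal{B}(X)=\bigcup_n\mathcal{B}_n(X)$.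 The entropy is $h(X) = \lim_{n\to\infty}\frac1n\log_2|\mathcal{B}_n(X)|$. Winning shifts: for a subshift $X\subset S^{\mathbb{N}}$, the winning shift is the winning set $W(X)\subset\{A,B\}^{\mathbb N}$, that is, the set of all $a\in\{A,B\}^{\mathbb N}$ such that $A$ has a winning strategy for the game with $n=\mathbb{N}$, target set $X$ and turn order $a$. For a subshift $X \subset S^{\mathbb{Z}}$, it is the two-directional subshift $W(X) = \mathcal{X}_F \subset \{A,B\}^{\mathbb{Z}}$ with $F = \{A,B\}^* \setminus W(\mathcal{B}(X))$.
   Formalization: The formal statement adds ε ≤ 1: as printed the claim fails for large ε (for the full binary shift, ε = 2e meets the condition but h(W(X)) ≤ 1), and it never holds for ε > 1; the case |S| = 1, where the quotient divides by zero, is vacuous. *)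

theory Defs
  imports Complex_Main "HOL-Library.Cardinality"
begin

text \<open>
  Throughout, the alphabet is the universe of a type \<open>'a\<close>; a word is an \<open>'a list\<close>.
\<close>

datatype player = PlayerA | PlayerB

subsection \<open>Word games\<close>

text \<open>
  A strategy is a function \<open>'a list \<Rightarrow> 'a\<close>. In a game of length \<open>n\<close> its values on words of
  length \<open>\<ge> n\<close> are never consulted. \<open>play a \<sigma> \<tau> n\<close> is the word built in the first \<open>n\<close> rounds
  when A follows \<open>\<sigma>\<close> and B follows \<open>\<tau>\<close>.
\<close>

primrec play ::
  "(nat \<Rightarrow> player) \<Rightarrow> ('a list \<Rightarrow> 'a) \<Rightarrow> ('a list \<Rightarrow> 'a) \<Rightarrow> nat \<Rightarrow> 'a list" where
  "play a \<sigma> \<tau> 0 = []"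
| "play a \<sigma> \<tau> (Suc n) =
     (let w = play a \<sigma> \<tau> n in w @ [case a n of PlayerA \<Rightarrow> \<sigma> w | PlayerB \<Rightarrow> \<tau> w])"

definition outcome ::
  "(nat \<Rightarrow> player) \<Rightarrow> ('a list \<Rightarrow> 'a) \<Rightarrow> ('a list \<Rightarrow> 'a) \<Rightarrow> nat \<Rightarrow> 'a" where
  "outcome a \<sigma> \<tau> i = play a \<sigma> \<tau> (Suc i) ! i"

definition winning_words :: "nat \<Rightarrow> 'a list set \<Rightarrow> player list set" where
  "winning_words n T = {a. length a = n \<and> (\<exists>\<sigma>. \<forall>\<tau>. play (nth a) \<sigma> \<tau> n \<in> T)}"

definition winning_language :: "'a list set \<Rightarrow> player list set" where
  "winning_language L = (\<Union>n. winning_words n (L \<inter> {w. length w = n}))"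

definition winning_set_nat :: "(nat \<Rightarrow> 'a) set \<Rightarrow> (nat \<Rightarrow> player) set" where
  "winning_set_nat X = {a. \<exists>\<sigma>. \<forall>\<tau>. outcome a \<sigma> \<tau> \<in> X}"

subsection \<open>Subshifts\<close>

text \<open>
  The index type \<open>'i\<close> is used only for \<open>nat\<close> (one-sided) and \<open>int\<close> (two-sided configurations).
\<close>

definition appears_in :: "'a list \<Rightarrow> ('i::semiring_1 \<Rightarrow> 'a) \<Rightarrow> bool" where
  "appears_in w x \<longleftrightarrow> (\<exists>i. \<forall>k<length w. x (i + of_nat k) = w ! k)"

definition avoiding_shift :: "'a list set \<Rightarrow> ('i::semiring_1 \<Rightarrow> 'a) set" where
  "avoiding_shift F = {x. \<forall>w\<in>F. \<not> appears_in w x}"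

definition subshift :: "('i::semiring_1 \<Rightarrow> 'a) set \<Rightarrow> bool" where
  "subshift X \<longleftrightarrow> (\<exists>F. X = avoiding_shift F)"

definition factors :: "nat \<Rightarrow> ('i::semiring_1 \<Rightarrow> 'a) set \<Rightarrow> 'a list set" where
  "factors n X = {w. length w = n \<and> (\<exists>x\<in>X. appears_in w x)}"

definition language :: "('i::semiring_1 \<Rightarrow> 'a) set \<Rightarrow> 'a list set" where
  "language X = (\<Union>n. factors n X)"

text \<open>
  Since \<open>log 2 0 = 0\<close>, the empty subshift gets entropy \<open>0\<close> here instead of \<open>- \<infinity>\<close>.
\<close>

definition entropy :: "('i::semiring_1 \<Rightarrow> 'a) set \<Rightarrow> real" where
  "entropy X = lim (\<lambda>n. log 2 (real (card (factors n X))) / real n)"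

definition winning_shift_int :: "(int \<Rightarrow> 'a) set \<Rightarrow> (int \<Rightarrow> player) set" where
  "winning_shift_int X = avoiding_shift (- winning_language (language X))"

end

theory Submission
  imports Defs
begin

text \<open>
  Splitting a target set \<open>L\<close> according to the first letter \<open>s\<close>, player A wins a turn order
  starting with A if the rest is won for some \<open>L\<^sub>s\<close>, and one starting with B if the rest is won
  for all \<open>L\<^sub>s\<close>. A turn order that is won for all \<open>|S|\<close> letters is thus counted twice, and any
  other one is won for at most \<open>|S| - 1\<close> letters, so induction gives
  \<open>|L| \<le> (|S| - 1)\<^sup>n |W(L)|\<close>. For \<open>L = B\<^sub>n(X)\<close> this yields \<open>h(W(X)) \<ge> h(X) - log\<^sub>2 (|S| - 1)\<close>,
  which exceeds \<open>\<epsilon>\<close> because \<open>2 \<le> 2e / \<epsilon>\<close>. In the one-sided case a winning word is extended by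
  giving all further turns to A. In the two-sided case winning words need not extend to the
  left, but the left-extendable words of a factorial language have the same growth rate as the
  language itself.
\<close>

subsection \<open>Subadditive sequences\<close>

lemma subadditive_le_mult_add:
  fixes a :: "nat \<Rightarrow> real"
  assumes sub: "\<And>m n. a (m + n) \<le> a m + a n"
  shows "a (q * m + r) \<le> real q * a m + a r"
proof (induction q)
  case (Suc q)
  have "a (Suc q * m + r) = a (m + (q * m + r))"
    by (simp add: algebra_simps)
  also have "\<dots> \<le> a m + a (q * m + r)"
    by (rule sub)
  finally show ?case
    using Suc by (simp add: algebra_simps)
qed simp

text \<open>Division with remainder \<open>n = q * m + r\<close> bounds \<open>a n / n\<close> by
  \<open>a m / m\<close> plus an error that vanishes as n grows. Choosing m with
  \<open>a m / m\<close> close to the infimum forces convergence to it; nonnegativity makes the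
  infimum exist.\<close>

lemma fekete:
  fixes a :: "nat \<Rightarrow> real"
  assumes sub: "\<And>m n. a (m + n) \<le> a m + a n"
    and nonneg: "\<And>n. 0 \<le> a n"
  shows "(\<lambda>n. a n / real n) \<longlonglongrightarrow> (INF n\<in>{1..}. a n / real n)"
proof (rule LIMSEQ_I)
  define l where "l = (INF n\<in>{1..}. a n / real n)"
  have bdd: "bdd_below ((\<lambda>n. a n / real n) ` {1..})"
    using nonneg by (intro bdd_belowI[where m = 0]) auto
  fix e :: real
  assume "0 < e"
  then have "l < l + e / 2" by simp
  then obtain m where m: "m \<ge> 1" "a m / real m < l + e / 2"
    unfolding l_def using cINF_less_iff[OF _ bdd, of "l + e / 2"] by (auto simp: l_def)
  \<comment> \<open>A sum of nonnegative terms dominates each of them, so \<open>M\<close> bounds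
    \<open>a r\<close> for every possible remainder r at once.\<close>
  define M where "M = (\<Sum>r<m. a r)"
  obtain N :: nat where N: "2 * M / e < real N"
    using reals_Archimedean2 by blast
  show "\<exists>N. \<forall>n\<ge>N. norm (a n / real n - (INF n\<in>{1..}. a n / real n)) < e"
  proof (intro exI allI impI)
    fix n
    assume n: "Suc N \<le> n"
    have "a n \<le> real (n div m) * a m + a (n mod m)"
      using subadditive_le_mult_add[of a "n div m" m "n mod m", OF sub] by simp
    moreover have "a (n mod m) \<le> M"
      unfolding M_def using m nonneg by (intro member_le_sum) auto
    moreover have "real (n div m) * a m \<le> real n * (a m / real m)"
    proof -
      have "real (n div m) * a m = real (n div m * m) * (a m / real m)"
        using m by simp
      also have "\<dots> \<le> real n * (a m / real m)"
        using nonneg by (intro mult_right_mono of_nat_mono div_times_less_eq_dividend) auto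
      finally show ?thesis .
    qed
    ultimately have "a n \<le> real n * (a m / real m) + M"
      by linarith
    then have "a n / real n \<le> a m / real m + M / real n"
      using n by (simp add: field_simps)
    moreover have "M / real n < e / 2"
    proof -
      have "2 * M / e < real n" using N n by linarith
      then show ?thesis using \<open>0 < e\<close> n by (simp add: field_simps)
    qed
    moreover have "l \<le> a n / real n"
      unfolding l_def using bdd n by (intro cINF_lower) auto
    ultimately show "norm (a n / real n - (INF n\<in>{1..}. a n / real n)) < e"
      using m unfolding l_def[symmetric] real_norm_def by linarith
  qed
qed

subsection \<open>Factors and entropy\<close>

lemma finite_length_eq: "finite {w :: 'a::finite list. P w \<and> length w = n}"
  by (rule finite_subset[OF _ finite_lists_length_eq[of UNIV n]]) auto

lemma finite_factors [simp]: "finite (factors n (X :: ('i::semiring_1 \<Rightarrow> 'a::finite) set))"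
  by (rule finite_subset[OF _ finite_lists_length_eq[of UNIV n]]) (auto simp: factors_def)

lemma appears_in_appendD:
  fixes x :: "'i::semiring_1 \<Rightarrow> 'a"
  assumes "appears_in (u @ v) x"
  shows "appears_in u x" "appears_in v x"
proof -
  obtain i where i: "\<And>k. k < length u + length v \<Longrightarrow> x (i + of_nat k) = (u @ v) ! k"
    using assms by (auto simp: appears_in_def)
  show "appears_in u x"
    unfolding appears_in_def using i by (intro exI[of _ i]) (auto simp: nth_append)
  show "appears_in v x"
    unfolding appears_in_def
  proof (intro exI[of _ "i + of_nat (length u)"] allI impI)
    fix k
    assume "k < length v"
    then show "x (i + of_nat (length u) + of_nat k) = v ! k"
      using i[of "length u + k"] by (simp add: add.assoc)
  qed
qed

lemma factors_appendD:
  assumes "u @ v \<in> factors (m + n) X" "length u = m"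
  shows "u \<in> factors m X" "v \<in> factors n X"
  using assms appears_in_appendD[of u v] by (auto simp: factors_def)

text \<open>An occurrence can always be read one coordinate further to the right. On the left this
  fails for index type \<open>nat\<close>, which is why later extensions are made on the
  right.\<close>

lemma factors_extend_right:
  fixes X :: "('i::semiring_1 \<Rightarrow> 'a) set"
  assumes "w \<in> factors n X"
  shows "\<exists>s. w @ [s] \<in> factors (Suc n) X"
proof -
  obtain x i where x: "length w = n" "x \<in> X" "\<And>k. k < n \<Longrightarrow> x (i + of_nat k) = w ! k"
    using assms by (auto simp: factors_def appears_in_def)
  then have "appears_in (w @ [x (i + of_nat n)]) x"
    unfolding appears_in_def by (intro exI[of _ i]) (auto simp: nth_append less_Suc_eq)
  with x show ?thesis by (auto simp: factors_def)
qed

lemma factors_nonempty: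
  fixes X :: "('i::semiring_1 \<Rightarrow> 'a) set"
  assumes "X \<noteq> {}"
  shows "factors n X \<noteq> {}"
proof -
  obtain x where "x \<in> X" using assms by blast
  moreover have "appears_in (map (\<lambda>k. x (of_nat k)) [0..<n]) x"
    unfolding appears_in_def by (intro exI[of _ 0]) auto
  ultimately have "map (\<lambda>k. x (of_nat k)) [0..<n] \<in> factors n X"
    by (auto simp: factors_def)
  then show ?thesis by blast
qed

lemma card_split_le:
  assumes "\<And>w. w \<in> L \<Longrightarrow> take m w \<in> A \<and> drop m w \<in> B" "finite A" "finite B"
  shows "card L \<le> card A * card B"
proof -
  have "inj_on (\<lambda>w. (take m w, drop m w)) L"
    by (rule inj_onI) (metis append_take_drop_id prod.inject)
  moreover have "(\<lambda>w. (take m w, drop m w)) ` L \<subseteq> A \<times> B"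
    using assms by auto
  ultimately have "card L \<le> card (A \<times> B)"
    using assms by (intro card_inj_on_le) auto
  then show ?thesis by (simp add: card_cartesian_product)
qed

lemma card_factors_add_le:
  fixes X :: "('i::semiring_1 \<Rightarrow> 'a::finite) set"
  shows "card (factors (m + n) X) \<le> card (factors m X) * card (factors n X)"
proof (rule card_split_le)
  fix w
  assume w: "w \<in> factors (m + n) X"
  then have "length (take m w) = m" by (simp add: factors_def)
  with w show "take m w \<in> factors m X \<and> drop m w \<in> factors n X"
    using factors_appendD[of "take m w" "drop m w" m n X] by simp
qed auto

text \<open>The log of the number of factors is subadditive and nonnegative, so Fekete's lemma
  applies. Since the limit is an infimum, it bounds every single quotient from below, which gives
  the second claim.\<close>

lemma
  fixes X :: "('i::semiring_1 \<Rightarrow> 'a::finite) set"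
  assumes "X \<noteq> {}"
  shows entropy_tendsto: "(\<lambda>n. log 2 (card (factors n X)) / n) \<longlonglongrightarrow> entropy X"
    and entropy_le: "n * entropy X \<le> log 2 (card (factors n X))"
proof -
  define a where "a n = log 2 (card (factors n X))" for n
  have pos: "card (factors n X) > 0" for n
    using factors_nonempty[OF assms] by (simp add: card_gt_0_iff)
  have nonneg: "0 \<le> a n" for n
    unfolding a_def using pos[of n] by (intro zero_le_log_cancel_iff[THEN iffD2]) auto
  have "a (m + n) \<le> a m + a n" for m n
  proof -
    have "real (card (factors (m + n) X)) \<le> real (card (factors m X)) * real (card (factors n X))"
      using card_factors_add_le[of m n X] by (simp flip: of_nat_mult)
    then have "a (m + n) \<le> log 2 (real (card (factors m X)) * real (card (factors n X)))"
      unfolding a_def using pos by simp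
    then show ?thesis
      unfolding a_def using pos[of m] pos[of n] by (subst (asm) log_mult_pos) simp_all
  qed
  then have lim: "(\<lambda>n. a n / n) \<longlonglongrightarrow> (INF n\<in>{1..}. a n / n)"
    using nonneg by (rule fekete)
  then have eq: "entropy X = (INF n\<in>{1..}. a n / n)"
    unfolding entropy_def a_def by (rule limI)
  then show "(\<lambda>n. log 2 (card (factors n X)) / n) \<longlonglongrightarrow> entropy X"
    using lim by (simp add: a_def)
  have "n * entropy X \<le> a n"
  proof (cases "n = 0")
    case False
    have "bdd_below ((\<lambda>n. a n / real n) ` {1..})"
      using nonneg by (intro bdd_belowI[where m = 0]) auto
    then have "entropy X \<le> a n / n"
      unfolding eq using False by (intro cINF_lower) auto
    then show ?thesis using False by (simp add: field_simps)
  qed (use nonneg in simp)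
  then show "n * entropy X \<le> log 2 (card (factors n X))"
    by (simp add: a_def)
qed

lemma entropy_geI:
  fixes X :: "('i::semiring_1 \<Rightarrow> 'a::finite) set"
  assumes "X \<noteq> {}" and "\<And>n. n * c \<le> log 2 (card (factors n X))"
  shows "c \<le> entropy X"
proof (rule tendsto_lowerbound[OF entropy_tendsto[OF assms(1)]])
  show "\<forall>\<^sub>F n in sequentially. c \<le> log 2 (card (factors n X)) / n"
    using eventually_gt_at_top[of 0]
    by eventually_elim (use assms(2) in \<open>simp add: field_simps\<close>)
qed simp

lemma entropy_eq_0:
  fixes X :: "('i::semiring_1 \<Rightarrow> 'a::finite) set"
  assumes "X = {} \<or> CARD('a) = 1"
  shows "entropy X = 0"
proof -
  have "card (factors n X) \<le> 1" for n
    using assms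
  proof
    assume "CARD('a) = 1"
    then have "card {w :: 'a list. set w \<subseteq> UNIV \<and> length w = n} = 1"
      by (subst card_lists_length_eq) auto
    moreover have "factors n X \<subseteq> {w. set w \<subseteq> UNIV \<and> length w = n}"
      by (auto simp: factors_def)
    ultimately show ?thesis
      using card_mono[OF finite_lists_length_eq[OF finite[of "UNIV :: 'a set"], of n]] by fastforce
  qed (simp add: factors_def)
  then have "card (factors n X) = 0 \<or> card (factors n X) = 1" for n
    by (simp add: le_Suc_eq)
  \<comment> \<open>The case \<open>k = 0\<close> rests on the default value
    \<open>log 2 0 = 0\<close>.\<close>
  moreover have "log 2 (real k) = 0" if "k = 0 \<or> k = 1" for k :: nat
    using that by (auto simp: log_def)
  ultimately have "log 2 (card (factors n X)) = 0" for n
    by blast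
  then show ?thesis
    unfolding entropy_def by (simp add: limI)
qed

subsection \<open>Counting winning turn orders\<close>

lemma length_play [simp]: "length (play a \<sigma> \<tau> n) = n"
  by (induction n) (auto simp: Let_def)

text \<open>Justifies splicing strategies: changes that take effect only from round n on leave the
  first n rounds alone.\<close>

lemma play_cong:
  assumes "\<And>i. i < n \<Longrightarrow> a i = a' i"
    and "\<And>w. length w < n \<Longrightarrow> \<sigma> w = \<sigma>' w" "\<And>w. length w < n \<Longrightarrow> \<tau> w = \<tau>' w"
  shows "play a \<sigma> \<tau> n = play a' \<sigma>' \<tau>' n"
  using assms by (induction n) (auto simp: Let_def split: player.split)

text \<open>After m rounds the rest is a game of its own, with shifted turn order and with
  strategies that remember the word already played.\<close>

lemma play_add:
  "play a \<sigma> \<tau> (m + n) = play a \<sigma> \<tau> m @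
     play (\<lambda>i. a (m + i)) (\<lambda>w. \<sigma> (play a \<sigma> \<tau> m @ w)) (\<lambda>w. \<tau> (play a \<sigma> \<tau> m @ w)) n"
  by (induction n) (auto simp: Let_def)

lemma winning_words_ConsA:
  assumes "a \<in> winning_words n {w. s # w \<in> L}"
  shows "PlayerA # a \<in> winning_words (Suc n) L"
proof -
  obtain \<sigma> where \<sigma>: "length a = n" "\<And>\<tau>. s # play (nth a) \<sigma> \<tau> n \<in> L"
    using assms by (auto simp: winning_words_def)
  \<comment> \<open>A opens with \<open>s\<close> and then follows \<open>\<sigma>\<close> as if
    that letter had not been written.\<close>
  define \<sigma>' where "\<sigma>' w = (if w = [] then s else \<sigma> (tl w))" for w
  have "play (nth (PlayerA # a)) \<sigma>' \<tau> (Suc n) \<in> L" for \<tau>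
    using play_add[of "nth (PlayerA # a)" \<sigma>' \<tau> 1 n] \<sigma>(2)
    by (simp add: \<sigma>'_def del: play.simps(2)) (simp add: \<sigma>'_def)
  with \<sigma>(1) show ?thesis unfolding winning_words_def by auto
qed

lemma winning_words_ConsB:
  assumes "\<And>s. a \<in> winning_words n {w. s # w \<in> L}"
  shows "PlayerB # a \<in> winning_words (Suc n) L"
proof -
  have "\<exists>\<sigma>. \<forall>\<tau>. s # play (nth a) \<sigma> \<tau> n \<in> L" for s
    using assms[of s] by (simp add: winning_words_def)
  then obtain \<sigma> where \<sigma>: "\<And>s \<tau>. s # play (nth a) (\<sigma> s) \<tau> n \<in> L"
    by metis
  \<comment> \<open>\<open>hd w\<close> is the letter B opened with, and it selects which strategy A
    follows. The value at the empty word is never consulted, as B moves first.\<close>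
  define \<sigma>' where "\<sigma>' w = \<sigma> (hd w) (tl w)" for w
  have "play (nth (PlayerB # a)) \<sigma>' \<tau> (Suc n) \<in> L" for \<tau>
    using play_add[of "nth (PlayerB # a)" \<sigma>' \<tau> 1 n] \<sigma>
    by (simp add: \<sigma>'_def del: play.simps(2)) (simp add: \<sigma>'_def)
  moreover have "length a = n"
    using assms by (simp add: winning_words_def)
  ultimately show ?thesis unfolding winning_words_def by auto
qed

lemma UNIV_player: "UNIV = {PlayerA, PlayerB}"
  using player.exhaust by auto

instance player :: finite
  by standard (simp add: UNIV_player)

lemma finite_winning_words [simp]: "finite (winning_words n L)"
  by (rule finite_subset[OF _ finite_lists_length_eq[of UNIV n]]) (auto simp: winning_words_def)

text \<open>Double counting: an element of the union lies in at most \<open>CARD('s) - 1\<close> of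
  the sets unless it lies in all of them, and then it is counted once more.\<close>

lemma sum_card_le_card_Union_Inter:
  fixes W :: "'s::finite \<Rightarrow> 'b set"
  assumes "\<And>s. finite (W s)"
  shows "(\<Sum>s\<in>UNIV. card (W s)) \<le> (CARD('s) - 1) * card (\<Union>s. W s) + card (\<Inter>s. W s)"
proof -
  let ?U = "\<Union>s. W s" and ?I = "\<Inter>s. W s"
  have fin: "finite ?U" using assms by simp
  have "(\<Sum>s\<in>UNIV. card (W s)) = (\<Sum>s\<in>UNIV. \<Sum>a\<in>?U. if a \<in> W s then 1 else 0)"
    using fin by (intro sum.cong refl) (auto simp: sum.If_cases intro: arg_cong[where f = card])
  also have "\<dots> = (\<Sum>a\<in>?U. card {s. a \<in> W s})"
    by (subst sum.swap) (simp add: sum.If_cases)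
  also have "\<dots> \<le> (\<Sum>a\<in>?U. (CARD('s) - 1) + (if a \<in> ?I then 1 else 0))"
  proof (rule sum_mono)
    fix a
    show "card {s. a \<in> W s} \<le> (CARD('s) - 1) + (if a \<in> ?I then 1 else 0)"
    proof (cases "a \<in> ?I")
      case False
      then have "{s. a \<in> W s} \<subset> UNIV" by blast
      then have "card {s. a \<in> W s} < CARD('s)" by (intro psubset_card_mono) auto
      with False show ?thesis by auto
    qed simp
  qed
  also have "\<dots> = (CARD('s) - 1) * card ?U + card (?U \<inter> ?I)"
    using fin by (subst sum.distrib) (simp add: sum.If_cases Int_def)
  also have "?U \<inter> ?I = ?I" by blast
  finally show ?thesis .
qed

lemma card_le_card_winning_words:
  fixes L :: "'a::finite list set"
  assumes "CARD('a) \<ge> 2" and "\<And>w. w \<in> L \<Longrightarrow> length w = n"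
  shows "card L \<le> (CARD('a) - 1) ^ n * card (winning_words n L)"
  using assms(2)
proof (induction n arbitrary: L)
  case 0
  then have "L = {} \<or> L = {[]}" by auto
  then show ?case by (auto simp: winning_words_def)
next
  case (Suc n)
  let ?q = "CARD('a) - 1"
  define D where "D s = {w. s # w \<in> L}" for s
  define W where "W s = winning_words n (D s)" for s
  have len: "length w = n" if "w \<in> D s" for s w
    using Suc.prems[of "s # w"] that by (simp add: D_def)
  have finD: "finite (D s)" for s
    by (rule finite_subset[OF _ finite_lists_length_eq[of UNIV n]]) (use len in auto)
  have L: "L = (\<Union>s. (#) s ` D s)"
  proof (intro equalityI subsetI)
    fix w
    assume "w \<in> L"
    with Suc.prems[of w] show "w \<in> (\<Union>s. (#) s ` D s)"
      by (cases w) (auto simp: D_def)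
  qed (auto simp: D_def)
  have "card L \<le> (\<Sum>s\<in>UNIV. card ((#) s ` D s))"
    by (subst L) (rule card_UN_le, simp)
  also have "\<dots> = (\<Sum>s\<in>UNIV. card (D s))"
    by (simp add: card_image)
  also have "\<dots> \<le> (\<Sum>s\<in>UNIV. ?q ^ n * card (W s))"
    unfolding W_def by (intro sum_mono Suc.IH len)
  also have "\<dots> = ?q ^ n * (\<Sum>s\<in>UNIV. card (W s))"
    by (simp add: sum_distrib_left)
  also have "\<dots> \<le> ?q ^ n * (?q * card (\<Union>s. W s) + card (\<Inter>s. W s))"
    by (intro mult_left_mono sum_card_le_card_Union_Inter) (auto simp: W_def)
  \<comment> \<open>With at least two letters \<open>?q\<close> is at least 1, so the intersection
    may be given the same weight as the union.\<close>
  also have "\<dots> \<le> ?q ^ n * (?q * card (\<Union>s. W s) + ?q * card (\<Inter>s. W s))"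
    using assms(1) by (intro mult_left_mono add_left_mono) auto
  also have "\<dots> = ?q ^ Suc n * (card (\<Union>s. W s) + card (\<Inter>s. W s))"
    by (simp add: algebra_simps)
  \<comment> \<open>Prefixing the union with A and the intersection with B makes them disjoint sets
    of winning turn orders.\<close>
  also have "card (\<Union>s. W s) + card (\<Inter>s. W s)
      = card ((#) PlayerA ` (\<Union>s. W s) \<union> (#) PlayerB ` (\<Inter>s. W s))"
  proof (subst card_Un_disjoint)
    show "finite ((#) PlayerB ` (\<Inter>s. W s))"
      by (intro finite_imageI finite_subset[of "\<Inter>s. W s" "W undefined"]) (auto simp: W_def)
  qed (auto simp: card_image W_def)
  also have "\<dots> \<le> card (winning_words (Suc n) L)"
    by (intro card_mono)
      (auto simp: W_def D_def intro: winning_words_ConsA winning_words_ConsB)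
  finally show ?case by simp
qed

text \<open>The word reached after n rounds is a factor, so some letter extends it to a longer
  factor, and A plays such a letter.\<close>

lemma winning_words_appendA:
  assumes "a \<in> winning_words n (factors n X)"
  shows "a @ [PlayerA] \<in> winning_words (Suc n) (factors (Suc n) X)"
proof -
  obtain \<sigma> where \<sigma>: "length a = n" "\<And>\<tau>. play (nth a) \<sigma> \<tau> n \<in> factors n X"
    using assms by (auto simp: winning_words_def)
  define \<sigma>' where "\<sigma>' w =
    (if length w < n then \<sigma> w else SOME s. w @ [s] \<in> factors (Suc n) X)" for w
  have "play (nth (a @ [PlayerA])) \<sigma>' \<tau> (Suc n) \<in> factors (Suc n) X" for \<tau>
  proof -
    have eq: "play (nth (a @ [PlayerA])) \<sigma>' \<tau> n = play (nth a) \<sigma> \<tau> n"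
      by (rule play_cong) (auto simp: \<sigma>(1) \<sigma>'_def nth_append)
    have "\<exists>s. play (nth a) \<sigma> \<tau> n @ [s] \<in> factors (Suc n) X"
      by (rule factors_extend_right[OF \<sigma>(2)])
    then show ?thesis
      using \<sigma>(1) by (simp add: eq Let_def \<sigma>'_def nth_append) (rule someI_ex)
  qed
  with \<sigma>(1) show ?thesis unfolding winning_words_def by auto
qed

text \<open>For the prefix, the game is stopped early. For the suffix, B's behaviour in the first m
  rounds is frozen, and A goes on winning from the position reached.\<close>

lemma winning_words_appendD:
  assumes "a @ b \<in> winning_words (m + n) (factors (m + n) X)" "length a = m"
  shows "a \<in> winning_words m (factors m X)" "b \<in> winning_words n (factors n X)"
proof -
  obtain \<sigma> where len: "length b = n"
    and \<sigma>: "\<And>\<tau>. play (nth (a @ b)) \<sigma> \<tau> (m + n) \<in> factors (m + n) X"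
    using assms by (auto simp: winning_words_def)
  have "play (nth a) \<sigma> \<tau> m \<in> factors m X" for \<tau>
  proof -
    have "play (nth a) \<sigma> \<tau> m = play (nth (a @ b)) \<sigma> \<tau> m"
      by (rule play_cong) (auto simp: assms(2) nth_append)
    with \<sigma>[of \<tau>] show ?thesis
      unfolding play_add by (metis factors_appendD(1) length_play)
  qed
  with assms(2) show "a \<in> winning_words m (factors m X)"
    unfolding winning_words_def by auto
  \<comment> \<open>An arbitrary behaviour of B in the first m rounds; it leads to the position
    \<open>u\<close>.\<close>
  fix \<tau>\<^sub>0
  define u where "u = play (nth (a @ b)) \<sigma> \<tau>\<^sub>0 m"
  have "play (nth b) (\<lambda>w. \<sigma> (u @ w)) \<tau> n \<in> factors n X" for \<tau>
  proof -
    \<comment> \<open>B steers to \<open>u\<close> with \<open>\<tau>\<^sub>0\<close> and then plays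
      the given \<open>\<tau>\<close> as if the game began there.\<close>
    define \<tau>' where "\<tau>' w = (if length w < m then \<tau>\<^sub>0 w else \<tau> (drop m w))" for w
    have u: "play (nth (a @ b)) \<sigma> \<tau>' m = u"
      unfolding u_def by (rule play_cong) (auto simp: \<tau>'_def)
    have "play (\<lambda>i. (a @ b) ! (m + i)) (\<lambda>w. \<sigma> (u @ w)) (\<lambda>w. \<tau>' (u @ w)) n \<in> factors n X"
      using \<sigma>[of \<tau>'] unfolding play_add u
      by (metis factors_appendD(2) length_play u)
    moreover have "length u = m" by (simp add: u_def)
    ultimately show ?thesis
      by (simp add: \<tau>'_def flip: assms(2))
  qed
  with len show "b \<in> winning_words n (factors n X)"
    unfolding winning_words_def by auto
qed

text \<open>The logarithmic form of the counting bound. It holds for every n, not only in the limit,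
  because \<open>entropy_le\<close> does.\<close>

lemma card_winning_words_ge:
  fixes X :: "('i::semiring_1 \<Rightarrow> 'a::finite) set"
  assumes "CARD('a) \<ge> 2" "X \<noteq> {}"
  shows "card (winning_words n (factors n X)) > 0"
    and "n * (entropy X - log 2 (real CARD('a) - 1)) \<le> log 2 (card (winning_words n (factors n X)))"
proof -
  let ?q = "real CARD('a) - 1" and ?W = "winning_words n (factors n X)"
  have pos: "card (factors n X) > 0"
    using factors_nonempty[OF assms(2)] by (simp add: card_gt_0_iff)
  have le: "card (factors n X) \<le> (CARD('a) - 1) ^ n * card ?W"
    using assms(1) by (intro card_le_card_winning_words) (auto simp: factors_def)
  with pos show W: "card ?W > 0"
    by (metis bot_nat_0.not_eq_extremum le_zero_eq mult_0_right)
  have q: "real (CARD('a) - 1) = ?q" "?q > 0"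
    using assms(1) by auto
  have "real (card (factors n X)) \<le> ?q ^ n * card ?W"
    using le by (metis of_nat_le_iff of_nat_mult of_nat_power q(1))
  then have "log 2 (card (factors n X)) \<le> log 2 (?q ^ n * card ?W)"
    using pos by simp
  also have "\<dots> = n * log 2 ?q + log 2 (card ?W)"
    using q(2) W by (subst log_mult_pos) (simp_all add: log_nat_power)
  finally show "n * (entropy X - log 2 ?q) \<le> log 2 (card ?W)"
    using entropy_le[OF assms(2), of n] by (simp add: algebra_simps)
qed

subsection \<open>One-sided subshifts\<close>

text \<open>A one-sided subshift is closed under dropping initial coordinates, so an occurrence can
  be moved to coordinate 0.\<close>

lemma factors_nat_prefix:
  fixes X :: "(nat \<Rightarrow> 'a) set"
  assumes "subshift X" "w \<in> factors n X"
  shows "\<exists>x\<in>X. \<forall>k<n. x k = w ! k"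
proof -
  obtain F where F: "X = avoiding_shift F"
    using assms(1) by (auto simp: subshift_def)
  obtain x i where x: "length w = n" "x \<in> X" "\<And>k. k < n \<Longrightarrow> x (i + k) = w ! k"
    using assms(2) by (auto simp: factors_def appears_in_def)
  have "appears_in v x" if "appears_in v (\<lambda>k. x (i + k))" for v
    using that unfolding appears_in_def by (metis add.assoc)
  with x(2) have "(\<lambda>k. x (i + k)) \<in> X"
    unfolding F avoiding_shift_def by auto
  then show ?thesis
    using x(3) by (intro bexI[of _ "\<lambda>k. x (i + k)"]) simp_all
qed

lemma play_take:
  assumes "m \<le> n"
  shows "play a \<sigma> \<tau> m = take m (play a \<sigma> \<tau> n)"
  using play_add[of a \<sigma> \<tau> m "n - m"] assms by simp

lemma outcome_eq_nth_play:
  assumes "i < n"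
  shows "outcome a \<sigma> \<tau> i = play a \<sigma> \<tau> n ! i"
  using play_take[of "Suc i" n a \<sigma> \<tau>] assms by (simp add: outcome_def)

lemma winning_words_subset_factors_nat:
  fixes X :: "(nat \<Rightarrow> 'a) set"
  assumes "subshift X"
  shows "winning_words n (factors n X) \<subseteq> factors n (winning_set_nat X)"
proof
  fix a
  assume "a \<in> winning_words n (factors n X)"
  then obtain \<sigma> where \<sigma>: "length a = n" "\<And>\<tau>. play (nth a) \<sigma> \<tau> n \<in> factors n X"
    by (auto simp: winning_words_def)
  \<comment> \<open>\<open>p w\<close> is a point of X starting with \<open>w\<close>; A copies it
    once \<open>w\<close> has been built.\<close>
  obtain p where p: "\<And>w. w \<in> factors n X \<Longrightarrow> p w \<in> X \<and> (\<forall>k<n. p w k = w ! k)"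
    using factors_nat_prefix[OF assms, of _ n] by metis
  define a' where "a' i = (if i < n then a ! i else PlayerA)" for i
  define \<sigma>' where "\<sigma>' w = (if length w < n then \<sigma> w else p (take n w) (length w))" for w
  have "outcome a' \<sigma>' \<tau> \<in> X" for \<tau>
  proof -
    define w where "w = play (nth a) \<sigma> \<tau> n"
    have w: "play a' \<sigma>' \<tau> n = w"
      unfolding w_def by (rule play_cong) (auto simp: a'_def \<sigma>'_def)
    have pw: "p w \<in> X" "\<And>k. k < n \<Longrightarrow> p w k = w ! k"
      using p[of w] \<sigma>(2) by (auto simp: w_def)
    \<comment> \<open>From round n on every turn is A's, so B cannot interfere with the
      copying.\<close>
    have "outcome a' \<sigma>' \<tau> i = p w i" for i
    proof (cases "i < n")
      case True
      then show ?thesis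
        using pw(2) by (simp add: outcome_eq_nth_play w)
    next
      case False
      then show ?thesis
        using play_take[of n i a' \<sigma>' \<tau>]
        by (simp add: outcome_def Let_def a'_def \<sigma>'_def nth_append flip: w)
    qed
    then have "outcome a' \<sigma>' \<tau> = p w" by (rule ext)
    with pw(1) show ?thesis by simp
  qed
  then have "a' \<in> winning_set_nat X"
    by (auto simp: winning_set_nat_def)
  moreover have "appears_in a a'"
    unfolding appears_in_def by (intro exI[of _ 0]) (auto simp: a'_def \<sigma>(1))
  ultimately show "a \<in> factors n (winning_set_nat X)"
    using \<sigma>(1) by (auto simp: factors_def)
qed

lemma entropy_winning_set_nat_ge:
  fixes X :: "(nat \<Rightarrow> 'a::finite) set"
  assumes "CARD('a) \<ge> 2" "X \<noteq> {}" "subshift X"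
  shows "entropy X - log 2 (real CARD('a) - 1) \<le> entropy (winning_set_nat X)"
proof (rule entropy_geI)
  have sub: "winning_words n (factors n X) \<subseteq> factors n (winning_set_nat X)" for n
    by (rule winning_words_subset_factors_nat[OF assms(3)])
  show "winning_set_nat X \<noteq> {}"
    using sub[of 0] card_winning_words_ge(1)[OF assms(1,2), of 0] by (auto simp: factors_def)
  fix n
  have "card (winning_words n (factors n X)) \<le> card (factors n (winning_set_nat X))"
    by (intro card_mono sub) simp
  then have "log 2 (card (winning_words n (factors n X)))
      \<le> log 2 (card (factors n (winning_set_nat X)))"
    using card_winning_words_ge(1)[OF assms(1,2), of n] by simp
  then show "n * (entropy X - log 2 (real CARD('a) - 1))
      \<le> log 2 (card (factors n (winning_set_nat X)))"
    using card_winning_words_ge(2)[OF assms(1,2), of n] by linarith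
qed

subsection \<open>Two-sided subshifts\<close>

text \<open>The extensions for different m need not be compatible;
  \<open>left_extendable_Cons\<close> recovers a coherent sequence of them.\<close>

definition left_extendable :: "'b list set \<Rightarrow> 'b list set" where
  "left_extendable L = {w. \<forall>m. \<exists>u. length u = m \<and> u @ w \<in> L}"

locale factorial_language =
  fixes L :: "'b::finite list set"
  assumes appendD1: "u @ v \<in> L \<Longrightarrow> u \<in> L"
    and appendD2: "u @ v \<in> L \<Longrightarrow> v \<in> L"
begin

text \<open>Each of the finitely many non-extendable words of length n has a left length at which
  extension fails, and closure under suffixes makes failure persist for longer contexts. Hence one
  threshold serves all words of length n.\<close>

lemma left_extendable_bound:
  "\<exists>m. \<forall>u w. length w = n \<longrightarrow> m \<le> length u \<longrightarrow> u @ w \<in> L \<longrightarrow> w \<in> left_extendable L"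
proof -
  have "\<exists>m. \<forall>u. length u = m \<longrightarrow> u @ w \<notin> L" if "w \<notin> left_extendable L" for w
    using that by (auto simp: left_extendable_def)
  then obtain f where f: "\<And>w u. w \<notin> left_extendable L \<Longrightarrow> length u = f w \<Longrightarrow> u @ w \<notin> L"
    by metis
  define m where "m = (\<Sum>w | length w = n. f w)"
  have "w \<in> left_extendable L" if *: "length w = n" "m \<le> length u" "u @ w \<in> L" for u w
  proof (rule ccontr)
    assume **: "w \<notin> left_extendable L"
    have "f w \<le> m"
      unfolding m_def using *(1) finite_length_eq[of "\<lambda>_. True" n] by (intro member_le_sum) auto
    then have "length (drop (length u - f w) u) = f w"
      using *(2) by simp
    with f[OF **] have "drop (length u - f w) u @ w \<notin> L" by blast
    moreover have "take (length u - f w) u @ drop (length u - f w) u @ w \<in> L"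
      using *(3) by (simp flip: append_assoc)
    ultimately show False using appendD2 by blast
  qed
  then show ?thesis by blast
qed

text \<open>Cut a word of length \<open>m + k * n\<close> into m initial letters and k blocks of
  length n. Each block has at least m letters to its left, so it is left-extendable; the induction
  peels off the last block.\<close>

lemma card_le_card_left_extendable:
  "\<exists>m. \<forall>k. card {w \<in> L. length w = m + k * n}
     \<le> CARD('b) ^ m * card {w \<in> left_extendable L. length w = n} ^ k"
proof -
  let ?E = "{w \<in> left_extendable L. length w = n}"
  obtain m where m: "\<And>u w. length w = n \<Longrightarrow> m \<le> length u \<Longrightarrow> u @ w \<in> L \<Longrightarrow> w \<in> left_extendable L"
    using left_extendable_bound[of n] by blast
  have "card {w \<in> L. length w = m + k * n} \<le> CARD('b) ^ m * card ?E ^ k" for k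
  proof (induction k)
    case 0
    have "card {w \<in> L. length w = m} \<le> card {w :: 'b list. set w \<subseteq> UNIV \<and> length w = m}"
      by (intro card_mono finite_lists_length_eq) auto
    then show ?case
      using card_lists_length_eq[of "UNIV :: 'b set" m] by simp
  next
    case (Suc k)
    have "card {w \<in> L. length w = m + Suc k * n}
        \<le> card {w \<in> L. length w = m + k * n} * card ?E"
    proof (rule card_split_le)
      fix w
      assume w: "w \<in> {w \<in> L. length w = m + Suc k * n}"
      then have "take (m + k * n) w @ drop (m + k * n) w \<in> L" by simp
      then show "take (m + k * n) w \<in> {w \<in> L. length w = m + k * n}
          \<and> drop (m + k * n) w \<in> ?E"
        using w m[of "drop (m + k * n) w" "take (m + k * n) w"]
          appendD1[of "take (m + k * n) w" "drop (m + k * n) w"] by auto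
    qed (auto intro: finite_length_eq)
    also have "\<dots> \<le> (CARD('b) ^ m * card ?E ^ k) * card ?E"
      by (intro mult_right_mono Suc.IH) simp
    finally show ?case by (simp add: algebra_simps)
  qed
  then show ?thesis by blast
qed

lemma log_card_left_extendable_ge:
  assumes pos: "\<And>N. card {w \<in> L. length w = N} > 0"
    and growth: "\<And>N. N * c \<le> log 2 (card {w \<in> L. length w = N})"
  shows "card {w \<in> left_extendable L. length w = n} > 0"
    and "n * c \<le> log 2 (card {w \<in> left_extendable L. length w = n})"
proof -
  let ?E = "{w \<in> left_extendable L. length w = n}"
  obtain m where m: "\<And>k. card {w \<in> L. length w = m + k * n} \<le> CARD('b) ^ m * card ?E ^ k"
    using card_le_card_left_extendable[of n] by (elim exE) (rule that, erule spec)
  show E: "card ?E > 0"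
  proof (rule ccontr)
    assume "\<not> ?thesis"
    then have "card ?E = 0" by linarith
    with m[of 1] pos[of "m + 1 * n"] show False
      by simp
  qed
  \<comment> \<open>The right-hand side does not depend on k, so the factor multiplied by k cannot
    be positive.\<close>
  have bound: "k * (n * c - log 2 (card ?E)) \<le> m * (log 2 CARD('b) - c)" for k :: nat
  proof -
    have "real (card {w \<in> L. length w = m + k * n}) \<le> real CARD('b) ^ m * real (card ?E) ^ k"
      using of_nat_mono[OF m[of k], where 'a = real] by (simp only: of_nat_mult of_nat_power)
    then have "log 2 (card {w \<in> L. length w = m + k * n})
        \<le> log 2 (real CARD('b) ^ m * real (card ?E) ^ k)"
      using pos[of "m + k * n"] by simp
    also have "\<dots> = m * log 2 CARD('b) + k * log 2 (card ?E)"
      using E by (subst log_mult_pos) (simp_all add: log_nat_power)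
    finally show ?thesis
      using growth[of "m + k * n"] by (simp add: algebra_simps)
  qed
  show "n * c \<le> log 2 (card ?E)"
  proof (rule ccontr)
    assume "\<not> ?thesis"
    then have "n * c - log 2 (card ?E) > 0" by simp
    then obtain k :: nat where "m * (log 2 CARD('b) - c) < k * (n * c - log 2 (card ?E))"
      using reals_Archimedean3 by blast
    with bound[of k] show False by simp
  qed
qed

text \<open>A Koenig-type step: in a left extension of \<open>w\<close> by \<open>Suc m\<close>
  letters, the letter next to \<open>w\<close> still has m letters before it, and m is the threshold
  for the longer word.\<close>

lemma left_extendable_Cons:
  assumes "w \<in> left_extendable L"
  shows "\<exists>p. p # w \<in> left_extendable L"
proof -
  obtain m where m: "\<And>u v. length v = Suc (length w) \<Longrightarrow> m \<le> length u \<Longrightarrow> u @ v \<in> L \<Longrightarrow>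
      v \<in> left_extendable L"
    using left_extendable_bound[of "Suc (length w)"] by blast
  obtain u where u: "length u = Suc m" "u @ w \<in> L"
    using assms by (auto simp: left_extendable_def)
  then obtain u' p where "u = u' @ [p]"
    by (metis append_butlast_last_id length_0_conv nat.distinct(1))
  with u m[of "p # w" u'] show ?thesis by auto
qed

text \<open>A bi-infinite point is built around the word: letters are prepended one at a time on the
  left, and \<open>b\<close> is repeated on the right. Every finite window lies inside a word of
  \<open>L\<close>.\<close>

lemma left_extendable_subset_factors:
  assumes right: "\<And>w. w \<in> L \<Longrightarrow> w @ [b] \<in> L"
  shows "{w \<in> left_extendable L. length w = n} \<subseteq> factors n (avoiding_shift (- L) :: (int \<Rightarrow> 'b) set)"
proof clarify
  fix w
  assume w: "w \<in> left_extendable L" and n: "n = length w"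
  have "\<exists>v. \<forall>k. (v k \<in> left_extendable L \<and> (k = 0 \<longrightarrow> v k = w)) \<and> (\<exists>p. v (Suc k) = p # v k)"
  proof (rule dependent_nat_choice)
    show "\<exists>v. v \<in> left_extendable L \<and> (0 = (0 :: nat) \<longrightarrow> v = w)"
      using w by blast
    show "\<exists>v'. (v' \<in> left_extendable L \<and> (Suc k = 0 \<longrightarrow> v' = w)) \<and> (\<exists>p. v' = p # v)"
      if "v \<in> left_extendable L \<and> (k = 0 \<longrightarrow> v = w)" for v k
      using that left_extendable_Cons[of v] by auto
  qed
  then obtain v where v: "\<And>k. v k \<in> left_extendable L" "v 0 = w" "\<And>k. \<exists>p. v (Suc k) = p # v k"
    by metis
  have vL: "v k \<in> L" for k
    using v(1)[of k] unfolding left_extendable_def by (auto dest: appendD2)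
  define x where "x i = (if i < 0 then hd (v (nat (- i)))
    else if nat i < length w then w ! nat i else b)" for i :: int
  \<comment> \<open>Read from coordinate \<open>-k\<close> onwards, the point spells
    \<open>v k\<close> followed by copies of \<open>b\<close>.\<close>
  have x: "x (int t - int k) = (if t < length (v k) then v k ! t else b)" for t k
  proof (induction k arbitrary: t)
    case 0
    then show ?case by (simp add: x_def v(2))
  next
    case (Suc k)
    obtain p where p: "v (Suc k) = p # v k" using v(3) by blast
    show ?case
    proof (cases t)
      case 0
      have "nat (int k + 1) = Suc k" by simp
      with 0 p show ?thesis by (simp add: x_def)
    next
      case (Suc t')
      with Suc.IH[of t'] p show ?thesis by simp
    qed
  qed
  have repl: "u @ replicate j b \<in> L" if "u \<in> L" for u j
  proof (induction j)
    case (Suc j)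
    then show ?case
      using right[of "u @ replicate j b"] by (simp add: replicate_append_same)
  qed (use that in simp)
  have "z \<in> L" if z: "appears_in z x" for z
  proof -
    obtain i where i: "\<And>r. r < length z \<Longrightarrow> x (i + int r) = z ! r"
      using z by (auto simp: appears_in_def)
    \<comment> \<open>\<open>k\<close> is large enough that the window starts at offset
      \<open>t\<close> in \<open>v k\<close> followed by copies of \<open>b\<close>; the padding in
      \<open>y\<close> reaches at least to the window's end.\<close>
    define k where "k = nat (- i)"
    define t where "t = nat (i + int k)"
    define y where "y = v k @ replicate (t + length z) b"
    have it: "i + int r = int (t + r) - int k" for r
      by (simp add: t_def k_def)
    have "z = take (length z) (drop t y)"
    proof (rule nth_equalityI)
      fix r
      assume "r < length z"
      then show "z ! r = take (length z) (drop t y) ! r"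
        using i[of r] unfolding it x by (auto simp: y_def nth_append less_diff_conv add.commute)
    qed (simp add: y_def)
    moreover have "take t y @ take (length z) (drop t y) @ drop (length z) (drop t y) \<in> L"
      unfolding append_take_drop_id unfolding y_def by (rule repl[OF vL])
    ultimately show ?thesis
      by (metis appendD1 appendD2)
  qed
  then have "x \<in> avoiding_shift (- L)"
    by (auto simp: avoiding_shift_def)
  moreover have "appears_in w x"
    unfolding appears_in_def by (intro exI[of _ 0]) (auto simp: x_def)
  ultimately show "w \<in> factors (length w) (avoiding_shift (- L) :: (int \<Rightarrow> 'b) set)"
    by (auto simp: factors_def)
qed

end

section \<open>The winning language of a two-sided subshift as a factorial language\<close>

lemma language_Int_length: "language X \<inter> {w. length w = n} = factors n X"
  by (auto simp: language_def factors_def)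

lemma mem_winning_language_iff:
  "a \<in> winning_language (language X)
     \<longleftrightarrow> a \<in> winning_words (length a) (factors (length a) X)"
  by (auto simp: winning_language_def language_Int_length) (auto simp: winning_words_def)

lemma winning_language_length:
  "{a \<in> winning_language (language X). length a = n} = winning_words n (factors n X)"
  by (auto simp: mem_winning_language_iff) (auto simp: winning_words_def)

lemma factorial_winning_language: "factorial_language (winning_language (language X))"
  by standard (auto simp: mem_winning_language_iff dest: winning_words_appendD)

lemma entropy_winning_shift_int_ge:
  fixes X :: "(int \<Rightarrow> 'a::finite) set"
  assumes "CARD('a) \<ge> 2" "X \<noteq> {}"
  shows "entropy X - log 2 (real CARD('a) - 1) \<le> entropy (winning_shift_int X)"
proof -
  let ?L = "winning_language (language X)"
  let ?c = "entropy X - log 2 (real CARD('a) - 1)"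
  define E where "E n = {w \<in> left_extendable ?L. length w = n}" for n
  interpret factorial_language ?L
    by (rule factorial_winning_language)
  have E: "card (E n) > 0" "n * ?c \<le> log 2 (card (E n))" for n
    unfolding E_def
    \<comment> \<open>Both growth hypotheses on the winning language are the two parts of
      \<open>card_winning_words_ge\<close>.\<close>
    by (rule log_card_left_extendable_ge[where c = ?c];
      unfold winning_language_length; rule card_winning_words_ge[OF assms])+
  have sub: "E n \<subseteq> factors n (winning_shift_int X)" for n
    unfolding E_def winning_shift_int_def
    by (intro left_extendable_subset_factors[where b = PlayerA])
      (simp add: mem_winning_language_iff winning_words_appendA)
  show ?thesis
  proof (rule entropy_geI)
    show "winning_shift_int X \<noteq> {}"
      using sub[of 0] E(1)[of 0] by (auto simp: factors_def)
    fix n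
    have "card (E n) \<le> card (factors n (winning_shift_int X))"
      by (intro card_mono sub) simp
    then have "log 2 (card (E n)) \<le> log 2 (card (factors n (winning_shift_int X)))"
      using E(1)[of n] by simp
    then show "n * ?c \<le> log 2 (card (factors n (winning_shift_int X)))"
      using E(2)[of n] by linarith
  qed
qed

section \<open>Excluding degenerate cases, comparing constants, and the conclusion\<close>

lemma entropy_gt_nontrivial:
  fixes X :: "('i::semiring_1 \<Rightarrow> 'a::finite) set"
  assumes "entropy X > log 2 (real CARD('a) - 1)"
  shows "CARD('a) \<ge> 2" "X \<noteq> {}"
proof -
  have "CARD('a) \<ge> 1" by (simp add: Suc_leI)
  then consider "CARD('a) = 1" | "real CARD('a) - 1 \<ge> 1" by linarith
  \<comment> \<open>For a one-letter alphabet the threshold is \<open>log 2 0\<close>, which is 0 by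
    default. A nonnegative threshold rules out both degenerate cases, whose entropy is 0.\<close>
  then have nn: "log 2 (real CARD('a) - 1) \<ge> 0"
    by cases (auto simp: log_def[of 2 0] simp del: of_nat_diff)
  with assms entropy_eq_0[of X] show "X \<noteq> {}" by auto
  have "CARD('a) \<noteq> 1"
    using nn assms entropy_eq_0[of X] by auto
  with \<open>CARD('a) \<ge> 1\<close> show "CARD('a) \<ge> 2"
    by linarith
qed

lemma epsilon_less:
  fixes \<epsilon> :: real
  assumes "0 < \<epsilon>" "\<epsilon> \<le> 1" "q > 0" and "(2 * exp 1 / \<epsilon>) powr \<epsilon> < 2 powr h / q"
  shows "\<epsilon> < h - log 2 q"
proof -
  \<comment> \<open>The bound \<open>\<epsilon> \<le> 1\<close> enters here; it makes the base at
    least 2, so the hypothesis can be compared with \<open>2 powr \<epsilon>\<close>.\<close>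
  have "\<epsilon> \<le> exp 1"
    using assms(2) exp_ge_add_one_self[of 1] by linarith
  then have "2 \<le> 2 * exp 1 / \<epsilon>"
    using assms(1) by (simp add: field_simps)
  then have "2 powr \<epsilon> \<le> (2 * exp 1 / \<epsilon>) powr \<epsilon>"
    using assms(1) by (intro powr_mono2) auto
  also have "\<dots> < 2 powr h / q" by fact
  also have "\<dots> = 2 powr (h - log 2 q)"
    using assms(3) by (simp add: powr_diff)
  finally show ?thesis by simp
qed

theorem proposition5p9:
  fixes \<epsilon> :: real
  assumes "0 < \<epsilon>" and "\<epsilon> \<le> 1"
  shows "(\<forall>X :: (nat \<Rightarrow> 'a::finite) set.
            subshift X
            \<longrightarrow> entropy X > log 2 (real CARD('a) - 1)
            \<longrightarrow> (2 * exp 1 / \<epsilon>) powr \<epsilon> < 2 powr entropy X / (real CARD('a) - 1)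
            \<longrightarrow> entropy (winning_set_nat X) \<ge> \<epsilon>)
       \<and> (\<forall>X :: (int \<Rightarrow> 'a) set.
            subshift X
            \<longrightarrow> entropy X > log 2 (real CARD('a) - 1)
            \<longrightarrow> (2 * exp 1 / \<epsilon>) powr \<epsilon> < 2 powr entropy X / (real CARD('a) - 1)
            \<longrightarrow> entropy (winning_shift_int X) \<ge> \<epsilon>)"
proof (intro conjI allI impI)
  fix X :: "(nat \<Rightarrow> 'a) set"
  assume X: "subshift X" "entropy X > log 2 (real CARD('a) - 1)"
    and *: "(2 * exp 1 / \<epsilon>) powr \<epsilon> < 2 powr entropy X / (real CARD('a) - 1)"
  note nontriv = entropy_gt_nontrivial[OF X(2)]
  have "\<epsilon> < entropy X - log 2 (real CARD('a) - 1)"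
    using nontriv(1) by (intro epsilon_less[OF assms _ *]) simp
  with entropy_winning_set_nat_ge[OF nontriv X(1)] show "entropy (winning_set_nat X) \<ge> \<epsilon>"
    by linarith
next
  fix X :: "(int \<Rightarrow> 'a) set"
  assume X: "entropy X > log 2 (real CARD('a) - 1)"
    and *: "(2 * exp 1 / \<epsilon>) powr \<epsilon> < 2 powr entropy X / (real CARD('a) - 1)"
  note nontriv = entropy_gt_nontrivial[OF X]
  have "\<epsilon> < entropy X - log 2 (real CARD('a) - 1)"
    using nontriv(1) by (intro epsilon_less[OF assms _ *]) simp
  with entropy_winning_shift_int_ge[OF nontriv] show "entropy (winning_shift_int X) \<ge> \<epsilon>"
    by linarith
qed

end
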